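(* Let $i\in\mathcal I$, $j\in\mathcal J$, $z_0\in\mathcal Z_0$ and $\mathcal S\in\overline{\mathcal S}_j(z_0)$, with right-angle vertex $w^{\mathrm{ctr}}_{\mathcal S}$, triangle index $\mathrm{idx}(\mathcal S)\in\{-1,1\}$, and horizontal and vertical legs of lengths $l_1,l_2>0$. Let $$A_{\mathcal S}=\begin{bmatrix}\mathrm{idx}(\mathcal S)/l_1&0\\0&\mathrm{idx}(\mathcal S)/l_2\end{bmatrix}.$$ Then, for $p\in\mathcal P$, $$\frac{\partial}{\partial p}\int_{\mathcal S+A_jp}q_{i,j,\mathcal S}(w,p)\,dw=\frac{1}{2\det(A_{\mathcal S})}\left(\frac{\partial q_{i,j}}{\partial w}(w^{\mathrm{ctr}}_{\mathcal S}+A_jp)\,A_j+\begin{bmatrix}\frac13&\frac13\end{bmatrix}A_{\mathcal S}^{-\top}\,\mathrm{Hess}_{q_{i,j}}(w^{\mathrm{ctr}}_{\mathcal S}+A_jp)\,A_j\right),$$ where $\mathrm{Hess}_{q_{i,j}}(w)$ is the Hessian of $q_{i,j}$ evaluated at $w$.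
   Context: Zonotope notation: for $c\in\mathbb R^n$ and $G=[g_1,\dots,g_\ell]\in\mathbb R^{n\times\ell}$, $\langle c,\;G\rangle=\{c+\sum_{k=1}^\ell\beta_kg_k\mid\beta_k\in[-1,1]\}$. $\mathcal W\subset\mathbb R^2$ is the world space; all planar sets considered (including the translated triangles $\mathcal S+A_jp$, $p\in\mathcal P$) lie in $\mathcal W$. $\mathcal I$ (obstacles) and $\mathcal J$ (time intervals) are finite index sets, $\mathcal Z_0\subset\mathbb R^6$ is the set of initial conditions, $\mathcal P\subset\mathbb R^{n_p}$ is the set of trajectory parameters. For each $(i,j)\in\mathcal I\times\mathcal J$, $q_{i,j}:\mathcal W\to[0,\infty)$ is a twice-differentiable probability density function; $\frac{\partial q_{i,j}}{\partial w}$ is its gradient as a row vector. $G^{\mathrm{obs}}$ is a constant matrix with 2 rows. For each $j$, $\xi_j(z_0,p)=\langle c_j(z_0)+A_jp,\;G_j\rangle\subset\mathbb R^2$ with $c_j:\mathcal Z_0\to\mathbb R^2$ linear, $A_j\in\mathbb R^{2\times n_p}$, and $G_j$ a matrix with 2 rows. Triangles: for a fixed positive integer $k$, cover the zonotope $\langle c_j(z_0),\;[G_j,G^{\mathrm{obs}}]\rangle$ by an axis-aligned $k\times k$ grid of rectangular cells of equal size. Each cell (width $l_1$, height $l_2$) is cut along the diagonal joining its upper-left and lower-right corners into two right-angled triangles: the lower one, with index $1$, whose right-angle vertex is the lower-left corner of the cell, and the upper one, with index $-1$, whose right-angle vertex is the upper-right corner. $\overline{\mathcal S}_j(z_0)$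 is the collection of those triangles having nonempty intersection with $\langle c_j(z_0),\;[G_j,G^{\mathrm{obs}}]\rangle$. For $\mathcal S\in\overline{\mathcal S}_j(z_0)$, $$q_{i,j,\mathcal S}(w,p)=q_{i,j}(w^{\mathrm{ctr}}_{\mathcal S}+A_jp)+\frac{\partial q_{i,j}}{\partial w}(w^{\mathrm{ctr}}_{\mathcal S}+A_jp)\,(w-w^{\mathrm{ctr}}_{\mathcal S}-A_jp)+\tfrac12(w-w^{\mathrm{ctr}}_{\mathcal S}-A_jp)^\top H_{\mathcal S}\,(w-w^{\mathrm{ctr}}_{\mathcal S}-A_jp),$$ where $H_{\mathcal S}\in\mathbb R^{2\times2}$ is obtained by taking the element-wise supremum of the Hessian of $q_{i,j}$ over $\mathcal S\oplus A_j\mathcal P=\{s+A_jp'\mid s\in\mathcal S,\,p'\in\mathcal P\}$ using interval arithmetic (so each entry is a finite real number at least the supremum of the corresponding Hessian entry); $H_{\mathcal S}$ does not depend on $w$ or $p$. Derivatives with respect to $p$ are row vectors in $\mathbb R^{1\times n_p}$. *)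

theory Defs
  imports "HOL-Analysis.Analysis"
begin

text \<open>A matrix with 2 rows is given as the list of its columns, so that the number of generators
  may vary with the index \<open>j\<close> and horizontal concatenation of matrices is \<open>@\<close>.\<close>

definition zonotope :: "real^2 \<Rightarrow> (real^2) list \<Rightarrow> (real^2) set" where
  "zonotope c gs =
     {c + (\<Sum>m<length gs. \<beta> m *\<^sub>R gs ! m) | \<beta> :: nat \<Rightarrow> real. \<forall>m<length gs. \<beta> m \<in> {-1..1}}"


text \<open>The world space need not be open, so derivatives on it are taken relative to it; at interior
  points these are the ordinary derivatives. The entry \<open>(a, b)\<close> of the Hessian is the \<open>b\<close>-th
  partial derivative of the \<open>a\<close>-th component of the gradient.\<close>

definition gradient_on :: "(real^2) set \<Rightarrow> (real^2 \<Rightarrow> real) \<Rightarrow> real^2 \<Rightarrow> real^2" where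
  "gradient_on W f w = (\<chi> a. frechet_derivative f (at w within W) (axis a 1))"

definition hessian_on :: "(real^2) set \<Rightarrow> (real^2 \<Rightarrow> real) \<Rightarrow> real^2 \<Rightarrow> real^2^2" where
  "hessian_on W f w = jacobian (gradient_on W f) (at w within W)"

definition twice_differentiable_on :: "(real^2 \<Rightarrow> real) \<Rightarrow> (real^2) set \<Rightarrow> bool" where
  "twice_differentiable_on f W \<longleftrightarrow> f differentiable_on W \<and> gradient_on W f differentiable_on W"

definition prob_density_on :: "(real^2 \<Rightarrow> real) \<Rightarrow> (real^2) set \<Rightarrow> bool" where
  "prob_density_on f W \<longleftrightarrow> (\<forall>w\<in>W. f w \<ge> 0) \<and> (f has_integral 1) W"


record triangle =
  ctr  :: "real^2"
  idx  :: int
  leg1 :: real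
  leg2 :: real

definition region :: "triangle \<Rightarrow> (real^2) set" where
  "region T = convex hull
     {ctr T, ctr T + vector [idx T * leg1 T, 0], ctr T + vector [0, idx T * leg2 T]}"

definition shifted_region :: "triangle \<Rightarrow> real^'n^2 \<Rightarrow> real^'n \<Rightarrow> (real^2) set" where
  "shifted_region T A p = (\<lambda>s. s + A *v p) ` region T"

text \<open>The \<open>k \<times> k\<close> grid with lower-left corner \<open>b\<close> and cells of width \<open>l $ 1\<close> and height \<open>l $ 2\<close>.\<close>

definition grid_box :: "nat \<Rightarrow> real^2 \<Rightarrow> real^2 \<Rightarrow> (real^2) set" where
  "grid_box k b l = cbox b (b + real k *\<^sub>R l)"

definition grid_triangles :: "nat \<Rightarrow> real^2 \<Rightarrow> real^2 \<Rightarrow> triangle set" where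
  "grid_triangles k b l =
     {\<lparr>ctr = b + vector [real m * l $ 1, real n * l $ 2], idx = 1, leg1 = l $ 1, leg2 = l $ 2\<rparr>
        | m n. m < k \<and> n < k} \<union>
     {\<lparr>ctr = b + vector [real (m + 1) * l $ 1, real (n + 1) * l $ 2], idx = -1,
        leg1 = l $ 1, leg2 = l $ 2\<rparr> | m n. m < k \<and> n < k}"

definition covering_triangles :: "nat \<Rightarrow> real^2 \<Rightarrow> real^2 \<Rightarrow> (real^2) set \<Rightarrow> triangle set" where
  "covering_triangles k b l Z = {T \<in> grid_triangles k b l. region T \<inter> Z \<noteq> {}}"

definition shape_matrix :: "triangle \<Rightarrow> real^2^2" where
  "shape_matrix T = vector [vector [idx T / leg1 T, 0], vector [0, idx T / leg2 T]]"


definition approx_density ::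
  "(real^2) set \<Rightarrow> (real^2 \<Rightarrow> real) \<Rightarrow> real^'n^2 \<Rightarrow> triangle \<Rightarrow> real^2^2 \<Rightarrow> real^2 \<Rightarrow> real^'n \<Rightarrow> real" where
  "approx_density W f A T H w p =
     (let v = ctr T + A *v p
      in f v + gradient_on W f v \<bullet> (w - v) + 1/2 * ((w - v) \<bullet> (H *v (w - v))))"

text \<open>The parameters \<open>p\<close> for which the integral over the shifted triangle is meaningful, i.e. the
  triangle stays in the world space. Derivatives in \<open>p\<close> are taken relative to this set. The two
  lemmas below show that this is the ordinary derivative if the world space is open, and also at
  interior points of any parameter set that keeps the triangle in the world space.\<close>

definition admissible_params :: "(real^2) set \<Rightarrow> real^'n^2 \<Rightarrow> triangle \<Rightarrow> (real^'n) set" where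
  "admissible_params W A T = {p. shifted_region T A p \<subseteq> W}"

lemma at_within_admissible_params_open:
  assumes "open W" "p \<in> admissible_params W A T"
  shows "at p within admissible_params W A T = at p"
proof -
  have "compact (shifted_region T A p)"
    unfolding shifted_region_def region_def
    by (intro compact_continuous_image continuous_intros compact_convex_hull) auto
  moreover have "shifted_region T A p \<subseteq> W"
    using assms(2) by (simp add: admissible_params_def)
  ultimately obtain e where e: "e > 0" "(\<Union>x\<in>shifted_region T A p. ball x e) \<subseteq> W"
    using \<open>open W\<close> by (metis compact_subset_open_imp_ball_epsilon_subset)
  have "isCont (\<lambda>p. A *v p) p"
    by (simp add: matrix_vector_mul_linear linear_continuous_at linear_linear)
  then obtain d where d: "d > 0" "\<And>p'. dist p' p < d \<Longrightarrow> dist (A *v p') (A *v p) < e"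
    using \<open>e > 0\<close> unfolding continuous_at_eps_delta by blast
  have "ball p d \<subseteq> admissible_params W A T"
  proof
    fix p' assume "p' \<in> ball p d"
    then have "dist (A *v p) (A *v p') < e" using d(2)[of p'] by (simp add: dist_commute)
    then have "s + A *v p' \<in> W" if "s \<in> region T" for s
      using that e(2) unfolding shifted_region_def by force
    then show "p' \<in> admissible_params W A T"
      by (auto simp: admissible_params_def shifted_region_def)
  qed
  then have "p \<in> interior (admissible_params W A T)"
    using d(1) by (meson centre_in_ball interiorI open_ball)
  then show ?thesis by (rule at_within_interior)
qed

lemma at_within_admissible_params_interior:
  assumes "p \<in> interior P" "P \<subseteq> admissible_params W A T"
  shows "at p within admissible_params W A T = at p"
  using assms at_within_interior interior_mono by blast

end

theory Submission
  imports Defs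
begin

text \<open>Every shifted triangle is the affine image, with linear part \<open>matrix_inv (shape_matrix S)\<close>, of
  the standard triangle, which has area \<open>1/2\<close> and centroid \<open>(1/3, 1/3)\<close>. A change of variables
  therefore turns the integral of the quadratic model into the constant and the linear Taylor term
  evaluated at the parameter, plus a second-order term that does not depend on the parameter.
  Differentiating this expression needs only the differentiability of the density and its gradient.\<close>

section \<open>Affine maps and change of variables\<close>

lemma absolutely_integrable_on_compact:
  fixes f :: "'a::euclidean_space \<Rightarrow> 'b::euclidean_space"
  assumes "compact S" "continuous_on S f"
  shows "f absolutely_integrable_on S"
  using borel_integrable_compact[OF assms]
  by (simp add: set_integrable_def integrable_completion borel_measurable_integrable)

lemma affine_image_convex_hull:
  fixes M :: "real^'n^'m"
  shows "(\<lambda>x. v + M *v x) ` (convex hull X) = convex hull ((\<lambda>x. v + M *v x) ` X)"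
proof -
  have "(\<lambda>x. v + M *v x) ` Y = (+) v ` ((*v) M ` Y)" for Y
    by (simp add: image_image)
  then show ?thesis
    by (simp add: convex_hull_translation convex_hull_linear_image)
qed

text \<open>The map has constant derivative \<open>M\<close>, injective because \<open>det M\<close>
  is nonzero, so the Jacobian factor leaves the integral. Compactness and continuity supply absolute
  integrability on the image.\<close>

lemma integral_affine_image:
  fixes f :: "real^'m::{finite,wellorder} \<Rightarrow> real" and M :: "real^'m::_^'m::_"
  assumes "det M \<noteq> 0" "compact S" and f: "continuous_on ((\<lambda>x. v + M *v x) ` S) f"
  shows "integral ((\<lambda>x. v + M *v x) ` S) f = \<bar>det M\<bar> * integral S (\<lambda>x. f (v + M *v x))"
proof -
  let ?g = "\<lambda>x. v + M *v x"
  \<comment> \<open>The change-of-variables theorem treats integrands with values in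
    \<open>real^'n\<close>. So \<open>f\<close> is lifted to \<open>real^1\<close>, and its single
    component is read off at the end.\<close>
  define h :: "real^'m::_ \<Rightarrow> real^1" where "h = (\<lambda>x. vec (f x))"
  have cont: "continuous_on S ?g"
    by (intro continuous_intros)
  have "compact (?g ` S)"
    by (rule compact_continuous_image[OF cont \<open>compact S\<close>])
  moreover have "continuous_on (?g ` S) h"
    unfolding h_def vec_def by (intro continuous_intros f)
  ultimately have h: "h absolutely_integrable_on ?g ` S"
    by (rule absolutely_integrable_on_compact)
  have "(?g has_derivative (*v) M) (at x within S)" for x
    by (auto intro!: derivative_eq_intros bounded_linear_imp_has_derivative
             simp: matrix_vector_mul_bounded_linear)
  moreover have "inj ((*v) M)"
    using \<open>det M \<noteq> 0\<close> inj_matrix_vector_mult invertible_det_nz by blast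
  then have "inj_on ?g S"
    by (simp add: inj_on_def)
  moreover have "S \<in> sets lebesgue"
    using \<open>compact S\<close> by (simp add: fmeasurableD lmeasurable_compact)
  ultimately have "(\<lambda>x. \<bar>det (matrix ((*v) M))\<bar> *\<^sub>R h (?g x)) absolutely_integrable_on S \<and>
      integral S (\<lambda>x. \<bar>det (matrix ((*v) M))\<bar> *\<^sub>R h (?g x)) = integral (?g ` S) h"
    using has_absolute_integral_change_of_variables[of S ?g "\<lambda>_. (*v) M" h "integral (?g ` S) h"] h
    by blast
  then have D: "(\<lambda>x. \<bar>det M\<bar> *\<^sub>R h (?g x)) integrable_on S"
      "integral S (\<lambda>x. \<bar>det M\<bar> *\<^sub>R h (?g x)) = integral (?g ` S) h"
    by (simp_all add: absolutely_integrable_on_def)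
  have "integral (?g ` S) f = integral (?g ` S) (\<lambda>x. h x $ 1)"
    by (simp add: h_def)
  also have "\<dots> = integral (?g ` S) h $ 1"
    using h by (intro integral_component_eq_cart) (simp add: absolutely_integrable_on_def)
  also have "\<dots> = integral S (\<lambda>x. (\<bar>det M\<bar> *\<^sub>R h (?g x)) $ 1)"
    unfolding D(2)[symmetric] by (rule integral_component_eq_cart[OF D(1), symmetric])
  also have "\<dots> = \<bar>det M\<bar> * integral S (\<lambda>x. f (?g x))"
    by (simp add: h_def)
  finally show ?thesis .
qed

section \<open>Area and first moments of the standard triangle\<close>

definition std_triangle :: "(real^2) set" where
  "std_triangle = convex hull {0, axis 1 1, axis 2 1}"

lemma compact_std_triangle: "compact std_triangle"
  unfolding std_triangle_def by (intro finite_imp_compact_convex_hull) simp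

lemma integrable_on_std_triangle:
  fixes f :: "real^2 \<Rightarrow> 'b::euclidean_space"
  shows "continuous_on std_triangle f \<Longrightarrow> f integrable_on std_triangle"
  by (simp add: absolutely_integrable_on_compact compact_std_triangle set_lebesgue_integral_eq_integral(1))

lemma integral_std_triangle_const: "integral std_triangle (\<lambda>_. c) = c / 2" for c :: real
proof -
  \<comment> \<open>This identifies the triangle with the standard simplex of dimension 2, whose
    volume is 1/2!.\<close>
  have "Basis = {axis 1 1, axis 2 1 :: real^2}"
    by (auto simp: Basis_vec_def UNIV_2)
  then have "measure lebesgue std_triangle = 1 / 2"
    using content_std_simplex[where 'a = "real^2"] compact_std_triangle
    by (simp add: std_triangle_def measure_completion compact_imp_closed borel_closed fact_numeral)
  then have "integral std_triangle (\<lambda>_. 1 :: real) = 1 / 2"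
    using lmeasure_integral[of std_triangle] compact_std_triangle by (simp add: lmeasurable_compact)
  then show ?thesis
    using integral_mult_right[of std_triangle c "\<lambda>_. 1"] by simp
qed

text \<open>The affine symmetries of the triangle permute its barycentric coordinates, so these have equal
  integrals.\<close>

lemma integral_std_triangle_id: "integral std_triangle (\<lambda>x. x) = vector [1/6, 1/6]"
proof -
  let ?I = "integral std_triangle"
  have int: "?I f = ?I (\<lambda>x. f (v + M *v x))"
    if "\<bar>det M\<bar> = 1" "(\<lambda>x. v + M *v x) ` std_triangle = std_triangle" "continuous_on UNIV f"
    for f :: "real^2 \<Rightarrow> real" and v M
    using integral_affine_image[of M std_triangle v f] that compact_std_triangle
      continuous_on_subset by force
  have "?I (\<lambda>x. x $ 1) = ?I (\<lambda>x. x $ 2)"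
  proof -
    \<comment> \<open>The reflection that swaps the vertices \<open>axis 1 1\<close> and
      \<open>axis 2 1\<close> and fixes 0.\<close>
    let ?M = "vector [vector [0, 1], vector [1, 0]] :: real^2^2"
    have "(\<lambda>x. 0 + ?M *v x) ` std_triangle = std_triangle"
      unfolding std_triangle_def affine_image_convex_hull
      by (rule arg_cong[of _ _ "(hull) convex"])
        (auto simp: vec_eq_iff forall_2 axis_def matrix_vector_mult_def sum_2)
    then show ?thesis
      using int[of ?M 0 "\<lambda>x. x $ 1"]
      by (simp add: det_2 matrix_vector_mult_def sum_2 continuous_on_component)
  qed
  moreover have "?I (\<lambda>x. x $ 1) = ?I (\<lambda>x. 1 - x $ 1 - x $ 2)"
  proof -
    \<comment> \<open>With the shift by \<open>axis 1 1\<close>, this map swaps the vertices 0 and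
      \<open>axis 1 1\<close>, fixes \<open>axis 2 1\<close>, and sends the first coordinate to the
      third barycentric one.\<close>
    let ?M = "vector [vector [- 1, - 1], vector [0, 1]] :: real^2^2"
    have "(\<lambda>x. axis 1 1 + ?M *v x) ` std_triangle = std_triangle"
      unfolding std_triangle_def affine_image_convex_hull
      by (rule arg_cong[of _ _ "(hull) convex"])
        (auto simp: vec_eq_iff forall_2 axis_def matrix_vector_mult_def sum_2)
    then show ?thesis
      using int[of ?M "axis 1 1" "\<lambda>x. x $ 1"]
      by (simp add: det_2 matrix_vector_mult_def sum_2 continuous_on_component axis_def algebra_simps)
  qed
  \<comment> \<open>The three barycentric coordinates sum to 1, so their equal integrals share the
    area 1/2.\<close>
  moreover have "?I (\<lambda>x. 1 - x $ 1 - x $ 2) = 1 / 2 - ?I (\<lambda>x. x $ 1) - ?I (\<lambda>x. x $ 2)"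
    using integral_std_triangle_const[of 1]
    by (subst integral_diff; (intro integrable_on_std_triangle continuous_intros)?)+ simp
  ultimately have "?I (\<lambda>x. x $ 1) = 1 / 6" "?I (\<lambda>x. x $ 2) = 1 / 6"
    by linarith+
  then show ?thesis
    by (simp add: vec_eq_iff forall_2 integrable_on_std_triangle)
qed

text \<open>Substituting \<open>w = v + M *v x\<close> removes \<open>v\<close> from the integrand.
  The affine part integrates to the area times its value at the centroid; the quadratic remainder
  depends on \<open>M\<close> and \<open>B\<close> alone.\<close>

lemma integral_affine_std_triangle_quadratic:
  fixes M B :: "real^2^2"
  assumes "det M \<noteq> 0"
  shows "integral ((\<lambda>x. v + M *v x) ` std_triangle)
           (\<lambda>w. a + b \<bullet> (w - v) + 1/2 * ((w - v) \<bullet> (B *v (w - v)))) =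
         \<bar>det M\<bar> / 2 * (a + b \<bullet> (M *v vector [1/3, 1/3])) +
         \<bar>det M\<bar> * integral std_triangle (\<lambda>x. 1/2 * ((M *v x) \<bullet> (B *v (M *v x))))"
proof -
  have lin: "integral std_triangle (\<lambda>x. b \<bullet> (M *v x)) = b \<bullet> (M *v vector [1/6, 1/6])"
    using integral_linear[of "\<lambda>x. x" std_triangle "\<lambda>x. b \<bullet> (M *v x)"]
    by (simp add: integrable_on_std_triangle integral_std_triangle_id o_def
         bounded_linear_inner_right_comp matrix_vector_mul_bounded_linear)
  \<comment> \<open>The first moment is the area 1/2 times the centroid.\<close>
  have "(vector [1/6, 1/6] :: real^2) = (1/2) *\<^sub>R vector [1/3, 1/3]"
    by (simp add: vec_eq_iff forall_2)
  then have half: "b \<bullet> (M *v vector [1/6, 1/6]) = 1/2 * (b \<bullet> (M *v vector [1/3, 1/3]))"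
    by (metis inner_scaleR_right matrix_vector_mult_scaleR)
  have "integral ((\<lambda>x. v + M *v x) ` std_triangle)
           (\<lambda>w. a + b \<bullet> (w - v) + 1/2 * ((w - v) \<bullet> (B *v (w - v)))) =
        \<bar>det M\<bar> * integral std_triangle
           (\<lambda>x. a + b \<bullet> (M *v x) + 1/2 * ((M *v x) \<bullet> (B *v (M *v x))))"
    by (subst integral_affine_image)
      (auto simp: assms compact_std_triangle intro!: continuous_intros
         bounded_linear.continuous_on[OF matrix_vector_mul_bounded_linear])
  also have "integral std_triangle
           (\<lambda>x. a + b \<bullet> (M *v x) + 1/2 * ((M *v x) \<bullet> (B *v (M *v x)))) =
        a / 2 + b \<bullet> (M *v vector [1/6, 1/6]) +
        integral std_triangle (\<lambda>x. 1/2 * ((M *v x) \<bullet> (B *v (M *v x))))"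
    by (subst integral_add; (intro integrable_on_std_triangle continuous_intros
          bounded_linear.continuous_on[OF matrix_vector_mul_bounded_linear])?)+
      (simp add: integral_std_triangle_const lin)
  finally show ?thesis
    by (simp add: half algebra_simps)
qed

section \<open>The shape matrix and the shifted triangle\<close>

lemma shape_matrix_inverse:
  assumes "idx T = 1 \<or> idx T = -1" "leg1 T > 0" "leg2 T > 0"
  shows det_shape_matrix: "det (shape_matrix T) = 1 / (leg1 T * leg2 T)"
    and matrix_inv_shape_matrix: "matrix_inv (shape_matrix T) =
          vector [vector [idx T * leg1 T, 0], vector [0, idx T * leg2 T]]"
proof -
  show "det (shape_matrix T) = 1 / (leg1 T * leg2 T)"
    using assms by (auto simp: det_2 shape_matrix_def)
  let ?D = "vector [vector [idx T * leg1 T, 0], vector [0, idx T * leg2 T]] :: real^2^2"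
  have "shape_matrix T ** ?D = mat 1" "?D ** shape_matrix T = mat 1"
    using assms
    by (auto simp: shape_matrix_def matrix_matrix_mult_def mat_def vec_eq_iff forall_2 sum_2)
  \<comment> \<open>\<open>matrix_inv\<close> is a choice among two-sided inverses, so uniqueness of
    the inverse has to be shown.\<close>
  then show "matrix_inv (shape_matrix T) = ?D"
    unfolding matrix_inv_def by (intro some_equality) (auto, metis matrix_mul_assoc matrix_mul_lid)
qed

text \<open>The columns of the inverse shape matrix are the signed legs, so 0 goes to the
  right-angle vertex and the axis vectors go to the other two vertices.\<close>

lemma shifted_region_eq_affine_image:
  fixes A :: "real^'n^2"
  assumes "idx T = 1 \<or> idx T = -1" "leg1 T > 0" "leg2 T > 0"
  shows "shifted_region T A p =
    (\<lambda>x. (ctr T + A *v p) + matrix_inv (shape_matrix T) *v x) ` std_triangle"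
proof -
  let ?D = "matrix_inv (shape_matrix T)"
  have "?D *v axis 1 1 = vector [idx T * leg1 T, 0]" "?D *v axis 2 1 = vector [0, idx T * leg2 T]"
    by (auto simp: matrix_inv_shape_matrix[OF assms] vec_eq_iff forall_2 matrix_vector_mult_def
         sum_2 axis_def)
  then have "region T = (\<lambda>x. ctr T + ?D *v x) ` std_triangle"
    by (simp add: region_def std_triangle_def affine_image_convex_hull)
  then show ?thesis
    by (simp add: shifted_region_def image_image algebra_simps)
qed

section \<open>Differentiation with respect to the parameter\<close>

text \<open>By linearity, the values on the axis vectors determine the derivative. Where derivatives
  within \<open>W\<close> are not unique, the gradient represents the one chosen by
  \<open>frechet_derivative\<close>.\<close>

lemma gradient_on_has_derivative:
  assumes "f differentiable (at w within W)"
  shows "(f has_derivative (\<lambda>h. gradient_on W f w \<bullet> h)) (at w within W)"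
proof -
  have f: "(f has_derivative frechet_derivative f (at w within W)) (at w within W)"
    using assms by (simp add: frechet_derivative_works)
  then interpret bounded_linear "frechet_derivative f (at w within W)"
    by (rule has_derivative_bounded_linear)
  have "frechet_derivative f (at w within W) h = gradient_on W f w \<bullet> h" for h
  proof -
    have "h = (h $ 1) *\<^sub>R axis 1 1 + (h $ 2) *\<^sub>R axis 2 1"
      by (simp add: vec_eq_iff forall_2 axis_def)
    then have "frechet_derivative f (at w within W) h =
        frechet_derivative f (at w within W) ((h $ 1) *\<^sub>R axis 1 1 + (h $ 2) *\<^sub>R axis 2 1)"
      by simp
    then show ?thesis
      by (simp only: add scaleR) (simp add: gradient_on_def inner_vec_def sum_2 mult.commute)
  qed
  with f show ?thesis
    by (simp add: fun_eq_iff has_derivative_eq_rhs)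
qed

text \<open>The parameter survives only in \<open>f\<close> and its gradient at the moved vertex;
  the term with \<open>H\<close> is a constant that differentiation removes.\<close>

lemma integral_approx_density:
  fixes A :: "real^'n^2"
  assumes "idx T = 1 \<or> idx T = -1" "leg1 T > 0" "leg2 T > 0"
  shows "integral (shifted_region T A p) (\<lambda>w. approx_density W f A T H w p) =
    1 / (2 * det (shape_matrix T)) *
      (f (ctr T + A *v p) + gradient_on W f (ctr T + A *v p) \<bullet>
         (matrix_inv (shape_matrix T) *v vector [1/3, 1/3])) +
    1 / det (shape_matrix T) * integral std_triangle
      (\<lambda>x. 1/2 * ((matrix_inv (shape_matrix T) *v x) \<bullet>
         (H *v (matrix_inv (shape_matrix T) *v x))))"
proof -
  have det: "\<bar>det (matrix_inv (shape_matrix T))\<bar> = 1 / det (shape_matrix T)"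
    unfolding matrix_inv_shape_matrix[OF assms] det_shape_matrix[OF assms]
    using assms by (auto simp: det_2 abs_mult)
  then have "det (matrix_inv (shape_matrix T)) \<noteq> 0"
    using assms by (auto simp: det_shape_matrix)
  from integral_affine_std_triangle_quadratic[OF this] show ?thesis
    by (simp add: approx_density_def Let_def shifted_region_eq_affine_image[OF assms] det)
qed

lemma integral_approx_density_has_derivative:
  fixes A :: "real^'n^2"
  assumes f: "twice_differentiable_on f W"
    and T: "idx T = 1 \<or> idx T = -1" "leg1 T > 0" "leg2 T > 0"
    and p: "p \<in> admissible_params W A T"
  shows "((\<lambda>p. integral (shifted_region T A p) (\<lambda>w. approx_density W f A T H w p))
          has_derivative
          (\<lambda>h. ((1 / (2 * det (shape_matrix T))) *\<^sub>R
                 (gradient_on W f (ctr T + A *v p) v* A +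
                  ((vector [1/3, 1/3] v* transpose (matrix_inv (shape_matrix T)))
                     v* hessian_on W f (ctr T + A *v p)) v* A)) \<bullet> h))
         (at p within admissible_params W A T)"
proof -
  let ?v = "\<lambda>p. ctr T + A *v p" and ?P = "admissible_params W A T"
  let ?m = "matrix_inv (shape_matrix T) *v vector [1/3, 1/3] :: real^2"
  \<comment> \<open>The right-angle vertex belongs to the triangle, so admissible parameters keep it
    in \<open>W\<close>. Derivatives within \<open>W\<close> can then be restricted to the image of
    \<open>?P\<close> for the chain rule.\<close>
  have "ctr T \<in> region T"
    unfolding region_def by (rule hull_inc) simp
  then have sub: "?v ` ?P \<subseteq> W"
    by (auto simp: admissible_params_def shifted_region_def)
  with p have v_in: "?v p \<in> W"
    by blast
  have v: "(?v has_derivative (*v) A) (at p within ?P)"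
    by (auto intro!: derivative_eq_intros bounded_linear_imp_has_derivative
             simp: matrix_vector_mul_bounded_linear)
  have "((\<lambda>p. f (?v p)) has_derivative (\<lambda>h. gradient_on W f (?v p) \<bullet> (A *v h))) (at p within ?P)"
  proof (rule has_derivative_in_compose[OF v])
    show "(f has_derivative (\<bullet>) (gradient_on W f (?v p))) (at (?v p) within ?v ` ?P)"
      using gradient_on_has_derivative has_derivative_subset[OF _ sub] f v_in
      by (metis differentiable_on_def twice_differentiable_on_def)
  qed
  moreover have "((\<lambda>p. gradient_on W f (?v p)) has_derivative (\<lambda>h. hessian_on W f (?v p) *v (A *v h)))
      (at p within ?P)"
  proof (rule has_derivative_in_compose[OF v])
    show "(gradient_on W f has_derivative (*v) (hessian_on W f (?v p))) (at (?v p) within ?v ` ?P)"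
      using jacobian_works has_derivative_subset[OF _ sub] f v_in
      unfolding hessian_on_def by (metis differentiable_on_def twice_differentiable_on_def)
  qed
  ultimately have deriv: "((\<lambda>p. C * (f (?v p) + gradient_on W f (?v p) \<bullet> ?m) + K) has_derivative
      (\<lambda>h. C * (gradient_on W f (?v p) \<bullet> (A *v h) +
        (hessian_on W f (?v p) *v (A *v h)) \<bullet> ?m))) (at p within ?P)" for C K
    by (auto intro!: derivative_eq_intros)
  \<comment> \<open>Each matrix acting on \<open>h\<close> is moved across the inner product, which
    turns the directional form into a row vector paired with \<open>h\<close>.\<close>
  have eq: "C * (gradient_on W f (?v p) \<bullet> (A *v h) + (hessian_on W f (?v p) *v (A *v h)) \<bullet> ?m) =
      (C *\<^sub>R (gradient_on W f (?v p) v* A +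
        ((vector [1/3, 1/3] v* transpose (matrix_inv (shape_matrix T)))
          v* hessian_on W f (?v p)) v* A)) \<bullet> h" for C h
    by (simp add: dot_lmul_matrix inner_add_left inner_commute[of _ ?m])
  show ?thesis
    unfolding integral_approx_density[OF T] by (rule deriv[unfolded eq])
qed

theorem mainTheorem4:
  fixes W :: "(real^2) set" and I :: "'i set" and J :: "'j set"
    and Z0 :: "(real^6) set" and P :: "(real^'n) set"
    and q :: "'i \<Rightarrow> 'j \<Rightarrow> real^2 \<Rightarrow> real"
    and G_obs :: "(real^2) list" and G :: "'j \<Rightarrow> (real^2) list"
    and c :: "'j \<Rightarrow> real^6 \<Rightarrow> real^2" and A :: "'j \<Rightarrow> real^'n^2"
    and k :: nat and corner cell :: "'j \<Rightarrow> real^6 \<Rightarrow> real^2"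
    and i :: 'i and j :: 'j and z0 :: "real^6" and S :: triangle and H :: "real^2^2"
    and p :: "real^'n"
  assumes "finite I" and "finite J"
    and density: "\<And>i j. i \<in> I \<Longrightarrow> j \<in> J \<Longrightarrow> prob_density_on (q i j) W"
    and smooth: "\<And>i j. i \<in> I \<Longrightarrow> j \<in> J \<Longrightarrow> twice_differentiable_on (q i j) W"
    and lin: "\<And>j. j \<in> J \<Longrightarrow> linear (c j)"
    and k_pos: "k > 0"
    and cell_pos: "\<And>j z0. j \<in> J \<Longrightarrow> z0 \<in> Z0 \<Longrightarrow> cell j z0 $ 1 > 0 \<and> cell j z0 $ 2 > 0"
    and cover: "\<And>j z0. j \<in> J \<Longrightarrow> z0 \<in> Z0 \<Longrightarrow>
          zonotope (c j z0) (G j @ G_obs) \<subseteq> grid_box k (corner j z0) (cell j z0)"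
    and in_world: "\<And>j z0 T p. j \<in> J \<Longrightarrow> z0 \<in> Z0 \<Longrightarrow>
          T \<in> covering_triangles k (corner j z0) (cell j z0) (zonotope (c j z0) (G j @ G_obs)) \<Longrightarrow>
          p \<in> P \<Longrightarrow> shifted_region T (A j) p \<subseteq> W"
    and i: "i \<in> I" and j: "j \<in> J" and z0: "z0 \<in> Z0"
    and S: "S \<in> covering_triangles k (corner j z0) (cell j z0) (zonotope (c j z0) (G j @ G_obs))"
    and H_bound: "\<And>p' w a b. p' \<in> P \<Longrightarrow> w \<in> shifted_region S (A j) p' \<Longrightarrow>
          hessian_on W (q i j) w $ a $ b \<le> H $ a $ b"
    and p: "p \<in> P"
  shows "((\<lambda>p. integral (shifted_region S (A j) p)
                 (\<lambda>w. approx_density W (q i j) (A j) S H w p))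
          has_derivative
          (\<lambda>h. ((1 / (2 * det (shape_matrix S))) *\<^sub>R
                 (gradient_on W (q i j) (ctr S + A j *v p) v* A j +
                  ((vector [1/3, 1/3] v* transpose (matrix_inv (shape_matrix S)))
                     v* hessian_on W (q i j) (ctr S + A j *v p)) v* A j)) \<bullet> h))
         (at p within admissible_params W (A j) S)"
proof -
  \<comment> \<open>Both families of grid triangles have index 1 or -1 and the positive cell sides
    as legs.\<close>
  have "idx S = 1 \<or> idx S = -1" "leg1 S > 0" "leg2 S > 0"
    using S cell_pos[OF j z0] by (auto simp: covering_triangles_def grid_triangles_def)
  moreover have "p \<in> admissible_params W (A j) S"
    using in_world[OF j z0 S p] by (simp add: admissible_params_def)
  ultimately show ?thesis
    by (intro integral_approx_density_has_derivative smooth i j)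
qed

end
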